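(* Let $\epsilon=\epsilon(n)$ satisfy $\epsilon\ge C_1\frac{\log n}{n}$ and $\epsilon\to0$ as $n\to\infty$. Then, asymptotically almost surely, the following hold for a fixed $\alpha$: 1. If $0<\alpha\le\pi$, then $\mathrm{conn}\big(\mathcal{N}(\mathbb{S}^1_\alpha(n,\epsilon))\big)=0$. 2. If $0<\alpha\le\pi$ and $\alpha\ne\frac{2\pi}{3}$, then $\chi\big(\mathbb{S}^1_\alpha(n,\epsilon)\big)=3$. 3. If $\alpha=\frac{2\pi}{3}$, then $\chi\big(\mathbb{S}^1_{2\pi/3}(n,\epsilon)\big)=4$.
   Context: $\mathbb{S}^1$ is the unit circle with geodesic (arclength) distance $\mathbf{d}$ and uniform probability measure. For $\alpha,\epsilon\ge 0$ and $X\subset\mathbb{S}^1$, $\mathbb{S}^1_\alpha(X,\epsilon)$ is the graph with vertex set $X$ and $x\sim y$ iff $x\ne y$ and $\alpha-\epsilon\le \mathbf{d}(x,y)\le\alpha+\epsilon$. The random $\epsilon$-distance graph $\mathbb{S}^1_\alpha(n,\epsilon)$ is $\mathbb{S}^1_\alpha(X,\epsilon)$ with $X=\{X_1,\dots,X_n\}$, where the $X_i$ are i.i.d. uniform on $\mathbb{S}^1$. An event (depending on $n$) holds asymptotically almost surely (a.a.s.) if its probability tends to $1$ as $n\to\infty$. $\chi$ is the chromatic number. A set $X\subset\mathbb{S}^1$ is a $\delta$-net if every point of $\mathbb{S}^1$ is at geodesic distance at most $\delta$ from some point of $X$. $C_1$ denotes a fixed constant with the property that whenever $\epsilon(n)\ge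 C_1\log n/n$ and $\epsilon(n)\to0$, a.a.s. $n$ i.i.d. uniform points of $\mathbb{S}^1$ form an $(\epsilon/4)$-net of $\mathbb{S}^1$ (such a constant exists). For a graph $G$, the neighborhood complex $\mathcal{N}(G)$ is the simplicial complex with vertex set $V(G)$ whose simplices are all $A\subset V(G)$ such that $\bigcap_{v\in A}N(v)\ne\emptyset$, where $N(v)$ is the set of neighbors of $v$. A nonempty space is $k$-connected ($k\ge0$) if for every $\ell=0,\dots,k$ every continuous map from $\mathbb{S}^\ell$ to it extends to the ball $\mathbb{B}^{\ell+1}$; $\mathrm{conn}(Y)$ is the largest $k$ such that $Y$ is $k$-connected (with $\mathrm{conn}(Y)=-1$ if $Y$ is nonempty but not $0$-connected). For a simplicial complex, these notions refer to its geometric realization. *)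

theory Defs
  imports "HOL-Probability.Probability"
begin

section \<open>The circle\<close>

abbreviation circle :: "complex set" where
  "circle \<equiv> sphere 0 1"

definition geodesic_dist :: "complex \<Rightarrow> complex \<Rightarrow> real" where
  "geodesic_dist x y = arccos (x \<bullet> y)"

definition uniform_circle :: "complex measure" where
  "uniform_circle =
     distr (uniform_measure lborel {0..<2 * pi}) (restrict_space borel circle) cis"

definition circle_net :: "real \<Rightarrow> complex set \<Rightarrow> bool" where
  "circle_net \<delta> X \<longleftrightarrow> X \<subseteq> circle \<and> (\<forall>y\<in>circle. \<exists>x\<in>X. geodesic_dist y x \<le> \<delta>)"

text \<open>
  The joint law of \<open>n\<close> independent uniform points \<open>x 1, \<dots>, x n\<close>. An event that depends on \<open>n\<close>
  is a predicate on the number of points and on the sample.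
\<close>

definition iid_circle :: "nat \<Rightarrow> (nat \<Rightarrow> complex) measure" where
  "iid_circle n = Pi\<^sub>M {1..n} (\<lambda>_. uniform_circle)"

definition aas :: "(nat \<Rightarrow> (nat \<Rightarrow> complex) \<Rightarrow> bool) \<Rightarrow> bool" where
  "aas P \<longleftrightarrow>
     (\<lambda>n. measure (iid_circle n) {x \<in> space (iid_circle n). P n x}) \<longlonglongrightarrow> 1"

text \<open>Both bounds are required from \<open>n = 1\<close> on; the index \<open>0\<close> carries no information.\<close>

definition net_constant :: "real \<Rightarrow> bool" where
  "net_constant C \<longleftrightarrow>
     (\<forall>\<epsilon>. (\<forall>n\<ge>1. \<epsilon> n \<ge> C * ln (real n) / real n) \<longrightarrow> \<epsilon> \<longlonglongrightarrow> 0 \<longrightarrow>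
          aas (\<lambda>n x. circle_net (\<epsilon> n / 4) (x ` {1..n})))"

section \<open>Graphs\<close>

record 'a sgraph =
  verts :: "'a set"
  adj :: "'a \<Rightarrow> 'a \<Rightarrow> bool"

definition neighbors :: "'a sgraph \<Rightarrow> 'a \<Rightarrow> 'a set" where
  "neighbors G v = {w \<in> verts G. adj G v w}"

definition colorable :: "'a sgraph \<Rightarrow> nat \<Rightarrow> bool" where
  "colorable G k \<longleftrightarrow>
     (\<exists>c :: 'a \<Rightarrow> nat. c ` verts G \<subseteq> {..<k} \<and>
        (\<forall>v\<in>verts G. \<forall>w\<in>verts G. adj G v w \<longrightarrow> c v \<noteq> c w))"

definition chromatic_number :: "'a sgraph \<Rightarrow> enat" where
  "chromatic_number G = (INF k\<in>{k. colorable G k}. enat k)"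

definition distance_graph :: "real \<Rightarrow> complex set \<Rightarrow> real \<Rightarrow> complex sgraph" where
  "distance_graph \<alpha> X \<epsilon> =
     \<lparr>verts = X,
      adj = (\<lambda>x y. x \<noteq> y \<and> \<alpha> - \<epsilon> \<le> geodesic_dist x y \<and> geodesic_dist x y \<le> \<alpha> + \<epsilon>)\<rparr>"

section \<open>Simplicial complexes and connectivity\<close>

text \<open>
  An abstract simplicial complex is given by its set of simplices. The empty simplex may be
  present; it contributes no point to the geometric realization.
\<close>

definition neighborhood_complex :: "'a sgraph \<Rightarrow> 'a set set" where
  "neighborhood_complex G =
     {A. finite A \<and> A \<subseteq> verts G \<and> (\<Inter>v\<in>A. neighbors G v) \<noteq> {}}"

text \<open>
  Points are given by barycentric coordinates, extended by zero to the whole type. The topology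
  is that of coordinatewise convergence, which is the usual one for complexes with finitely many
  vertices, the only case needed here.
\<close>

definition geometric_realization :: "'a set set \<Rightarrow> ('a \<Rightarrow> real) topology" where
  "geometric_realization K =
     subtopology (powertop_real UNIV)
       {f. (\<forall>v. 0 \<le> f v) \<and> {v. f v \<noteq> 0} \<in> K \<and> (\<Sum>v\<in>{v. f v \<noteq> 0}. f v) = 1}"

text \<open>The closed unit ball of dimension \<open>n\<close>; the sphere \<open>nsphere n\<close> bounds \<open>nball (Suc n)\<close>.\<close>

definition nball :: "nat \<Rightarrow> (nat \<Rightarrow> real) topology" where
  "nball n = subtopology (Euclidean_space n) {x. (\<Sum>i<n. x i ^ 2) \<le> 1}"

text \<open>For \<open>k = -1\<close> this says that the space is nonempty.\<close>

definition k_connected :: "int \<Rightarrow> 'a topology \<Rightarrow> bool" where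
  "k_connected k Y \<longleftrightarrow> topspace Y \<noteq> {} \<and>
     (\<forall>l::nat. int l \<le> k \<longrightarrow>
        (\<forall>f. continuous_map (nsphere l) Y f \<longrightarrow>
           (\<exists>g. continuous_map (nball (Suc l)) Y g \<and>
                (\<forall>x\<in>topspace (nsphere l). g x = f x))))"

text \<open>
  The value is \<open>\<infinity>\<close> if the space is \<open>k\<close>-connected for all \<open>k\<close>, and \<open>-\<infinity>\<close> if it is empty.
\<close>

definition conn :: "'a topology \<Rightarrow> ereal" where
  "conn Y = (SUP k\<in>{k. -1 \<le> k \<and> k_connected k Y}. ereal (of_int k))"

end

theory Submission
  imports Defs
begin

text \<open>
  If two points of \<open>X\<close> are close to a point \<open>y\<close> of the circle, then the net property gives a vertex
  near \<open>y * cis \<alpha>\<close> that is adjacent to both. For this reason a 2-colouring, and for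
  \<open>\<alpha> = 2 * pi / 3\<close> (where \<open>y * cis \<alpha>\<close> and \<open>y * cis (-\<alpha>)\<close> complete a triangle) even a 3-colouring,
  would be locally constant on the net, hence constant on \<open>X\<close>. Cyclic colourings of equal arcs
  give the upper bounds.

  The same observation yields a map \<open>loop\<close> from the circle to the neighborhood complex, to which
  every point can be joined by segments, so the complex is path-connected. By Dirichlet's theorem some
  multiple \<open>d * \<alpha>\<close> is close to a multiple of \<open>pi\<close>; then the \<open>d\<close>-th powers of the vertices of a
  simplex all lie in one open half plane, so \<open>f \<mapsto> (\<Sum>v. f v * v ^ d)\<close> maps the complex to
  the punctured plane. Along \<open>loop\<close> it stays near \<open>y ^ d\<close>, so \<open>loop\<close> does not bound a disc.
\<close>

section \<open>Geodesic distance on the circle\<close>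

text \<open>The map \<open>arccos \<circ> cos\<close> folds the real line onto [0, pi] without
  increasing distances, and it fixes \<open>a\<close>. Since \<open>a + w\<close> lies in
  [-pi, 2 pi], at most one reflection, at 0 or at pi, takes place.\<close>

lemma arccos_cos_near:
  assumes "0 \<le> a" "a \<le> pi" "\<bar>w\<bar> \<le> pi"
  shows "\<bar>arccos (cos (a + w)) - a\<bar> \<le> \<bar>w\<bar>"
proof -
  consider "0 \<le> a + w" "a + w \<le> pi" | "a + w < 0" | "pi < a + w"
    by linarith
  then show ?thesis
  proof cases
    case 1
    then show ?thesis by (simp add: arccos_cos)
  next
    case 2
    then have "arccos (cos (a + w)) = -(a + w)"
      using assms by (intro arccos_cos2) auto
    then show ?thesis using 2 assms by linarith
  next
    case 3
    have "cos (a + w) = cos (2 * pi - (a + w))"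
      by (simp add: cos_diff)
    then have "arccos (cos (a + w)) = 2 * pi - (a + w)"
      using 3 assms by (simp only:) (intro arccos_cos, auto)
    then show ?thesis using 3 assms by linarith
  qed
qed

lemma cis_Arg_circle: "x \<in> circle \<Longrightarrow> cis (Arg x) = x"
  by (subst cis_Arg) (auto simp: sgn_div_norm)

lemma circle_cisE:
  assumes "x \<in> circle"
  obtains t where "-pi < t" "t \<le> pi" "x = cis t"
  using assms cis_Arg_circle[of x] Arg_bounded[of x] that by metis

lemma cis_in_circle [simp]: "cis t \<in> circle"
  by simp

lemma mult_cis_in_circle: "y \<in> circle \<Longrightarrow> y * cis t \<in> circle"
  by (simp add: norm_mult)

lemma geodesic_dist_mult_cis:
  assumes "y \<in> circle"
  shows "geodesic_dist (y * cis a) (y * cis b) = arccos (cos (b - a))"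
proof -
  obtain t where "y = cis t" using assms circle_cisE by metis
  then show ?thesis
    by (simp add: geodesic_dist_def inner_complex_def cis_mult flip: cos_diff)
      (metis add_diff_cancel_left cos_minus minus_diff_eq)
qed

lemma geodesic_dist_commute: "geodesic_dist x y = geodesic_dist y x"
  by (simp add: geodesic_dist_def inner_commute)

lemma geodesic_dist_self: "x \<in> circle \<Longrightarrow> geodesic_dist x x = 0"
  using geodesic_dist_mult_cis[of x 0 0] by simp

text \<open>The signed angle from \<open>x\<close> to \<open>y\<close> serves as a coordinate
  centred at \<open>x\<close>; it turns metric statements on the circle into statements about real
  numbers.\<close>

lemma circle_eq_mult_cis:
  assumes "x \<in> circle" "y \<in> circle"
  obtains t where "y = x * cis t" "\<bar>t\<bar> = geodesic_dist x y"
proof -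
  have xy: "y / x \<in> circle" using assms by (simp add: norm_divide)
  then obtain t where t: "-pi < t" "t \<le> pi" "y / x = cis t"
    by (rule circle_cisE)
  have y: "y = x * cis t"
    using t assms by (metis mult.commute nonzero_eq_divide_eq mem_sphere_0 norm_zero zero_neq_one)
  have "geodesic_dist x y = arccos (cos t)"
    using geodesic_dist_mult_cis[OF assms(1), of 0 t] y by simp
  also have "\<dots> = \<bar>t\<bar>"
    using t by (cases "t \<ge> 0") (auto simp: arccos_cos arccos_cos2)
  finally show ?thesis using that y by auto
qed

text \<open>Moving both endpoints of an arc of length \<open>a\<close> changes its length by at most
  the sum of the two moves. The condition on \<open>s\<close> covers both directions of
  rotation.\<close>

lemma geodesic_dist_mult_cis_near:
  assumes "y \<in> circle" "u \<in> circle" "v \<in> circle" "0 \<le> a" "a \<le> pi" "\<bar>s\<bar> = a"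
    and "geodesic_dist y u + geodesic_dist (y * cis s) v \<le> r" "r \<le> pi"
  shows "\<bar>geodesic_dist u v - a\<bar> \<le> r"
proof -
  obtain p where p: "u = y * cis p" "\<bar>p\<bar> = geodesic_dist y u"
    using assms circle_eq_mult_cis by metis
  obtain q where q: "v = y * cis s * cis q" "\<bar>q\<bar> = geodesic_dist (y * cis s) v"
    using assms circle_eq_mult_cis mult_cis_in_circle by metis
  have v: "v = y * cis (s + q)" using q by (simp add: cis_mult mult.assoc)
  have d: "geodesic_dist u v = arccos (cos (s + (q - p)))"
    unfolding p(1) v using assms(1) by (simp add: geodesic_dist_mult_cis algebra_simps)
  \<comment> \<open>For negative \<open>s\<close> the evenness of cosine reflects the configuration,
    so \<open>w\<close> is \<open>q - p\<close> or \<open>p - q\<close> according to the sign of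
    \<open>s\<close>.\<close>
  have "\<exists>w. cos (s + (q - p)) = cos (a + w) \<and> \<bar>w\<bar> = \<bar>q - p\<bar>"
  proof (cases "s \<ge> 0")
    case True
    then show ?thesis using assms(6) by auto
  next
    case False
    then have "cos (s + (q - p)) = cos (a + (p - q))"
      using assms(6) cos_minus[of "a + (p - q)"] by (auto simp: algebra_simps abs_if)
    then show ?thesis by (metis abs_minus_commute)
  qed
  then obtain w where w: "cos (s + (q - p)) = cos (a + w)" "\<bar>w\<bar> = \<bar>q - p\<bar>" by blast
  moreover have "\<bar>q - p\<bar> \<le> r" using p(2) q(2) assms(7) by linarith
  ultimately show ?thesis
    using arccos_cos_near[of a w] assms d by auto
qed

lemma continuous_on_geodesic_dist:
  assumes "x \<in> circle"
  shows "continuous_on circle (\<lambda>y. geodesic_dist y x)"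
  unfolding geodesic_dist_def
proof (intro continuous_on_arccos' continuous_intros ballI)
  fix y :: complex assume "y \<in> circle"
  then have "\<bar>y \<bullet> x\<bar> \<le> 1"
    using Cauchy_Schwarz_ineq2[of y x] assms by simp
  then show "-1 \<le> y \<bullet> x \<and> y \<bullet> x \<le> 1" by linarith
qed

text \<open>If two colours occurred, the closed \<delta>-neighbourhoods of the points coloured like
  \<open>u\<close> and of all other points of \<open>X\<close> would cover the connected circle.
  They would then meet, and a common point contradicts \<open>same\<close>.\<close>

lemma constant_on_net:
  assumes "finite X" "circle_net \<delta> X"
    and same: "\<And>y u v. \<lbrakk>y \<in> circle; u \<in> X; v \<in> X; geodesic_dist y u \<le> \<delta>; geodesic_dist y v \<le> \<delta>\<rbrakk>
        \<Longrightarrow> c u = c v"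
    and "u \<in> X" "v \<in> X"
  shows "c u = c v"
proof (rule ccontr)
  assume neq: "c u \<noteq> c v"
  have X: "X \<subseteq> circle" using assms by (simp add: circle_net_def)
  define B where "B P = (\<Union>x\<in>{x\<in>X. P (c x)}. {y\<in>circle. geodesic_dist y x \<le> \<delta>})" for P
  have clo: "closed (B P)" for P
    unfolding B_def using X assms(1)
    by (intro closed_UN ballI continuous_on_closed_Collect_le continuous_on_geodesic_dist) auto
  \<comment> \<open>This puts every point of \<open>X\<close> into its own neighbourhood, so that
    both closed sets are nonempty.\<close>
  have \<delta>: "0 \<le> \<delta>"
  proof -
    obtain x where "x \<in> X" "geodesic_dist u x \<le> \<delta>"
      using assms(2,4) X unfolding circle_net_def by blast
    moreover have "0 \<le> geodesic_dist u x"
      using circle_eq_mult_cis[of u x] assms X calculation by (metis abs_ge_zero subsetD)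
    ultimately show ?thesis by simp
  qed
  have mem: "w \<in> B P" if "w \<in> X" "P (c w)" for w P
    using that \<delta> X geodesic_dist_self[of w] unfolding B_def by fastforce
  have "connected circle"
    by (rule connected_sphere) simp
  moreover have "circle \<subseteq> B (\<lambda>k. k = c u) \<union> B (\<lambda>k. k \<noteq> c u)"
    using assms(2) unfolding B_def circle_net_def by fast
  moreover have "B (\<lambda>k. k = c u) \<inter> B (\<lambda>k. k \<noteq> c u) \<inter> circle = {}"
  proof -
    have False if "y \<in> B (\<lambda>k. k = c u)" "y \<in> B (\<lambda>k. k \<noteq> c u)" for y
    proof -
      obtain a b where "y \<in> circle" "a \<in> X" "b \<in> X" "c a = c u" "c b \<noteq> c u"
          "geodesic_dist y a \<le> \<delta>" "geodesic_dist y b \<le> \<delta>"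
        using \<open>y \<in> B (\<lambda>k. k = c u)\<close> \<open>y \<in> B (\<lambda>k. k \<noteq> c u)\<close> unfolding B_def by blast
      then show False using same[of y a b] by simp
    qed
    then show ?thesis by blast
  qed
  moreover have "B (\<lambda>k. k = c u) \<inter> circle \<noteq> {}" "B (\<lambda>k. k \<noteq> c u) \<inter> circle \<noteq> {}"
  proof -
    have "u \<in> B (\<lambda>k. k = c u)" "v \<in> B (\<lambda>k. k \<noteq> c u)"
      using mem assms(4,5) neq by simp_all
    moreover have "u \<in> circle" "v \<in> circle" using assms(4,5) X by blast+
    ultimately show "B (\<lambda>k. k = c u) \<inter> circle \<noteq> {}" "B (\<lambda>k. k \<noteq> c u) \<inter> circle \<noteq> {}"
      by blast+
  qed
  ultimately show False
    using clo[of "\<lambda>k. k = c u"] clo[of "\<lambda>k. k \<noteq> c u"] unfolding connected_closed by (metis (lifting))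
qed

section \<open>Colourings\<close>

text \<open>The difference of the two floors is at least 1 and less than \<open>q\<close>, so
  \<open>q\<close> does not divide it.\<close>

lemma floor_mod_neq:
  fixes u s :: real and q :: int
  assumes "1 \<le> s" "s \<le> of_int q - 1"
  shows "\<lfloor>u\<rfloor> mod q \<noteq> \<lfloor>u + s\<rfloor> mod q"
proof
  assume "\<lfloor>u\<rfloor> mod q = \<lfloor>u + s\<rfloor> mod q"
  then have "q dvd \<lfloor>u + s\<rfloor> - \<lfloor>u\<rfloor>"
    by (metis mod_eq_dvd_iff)
  moreover have "1 \<le> \<lfloor>u + s\<rfloor> - \<lfloor>u\<rfloor>" "\<lfloor>u + s\<rfloor> - \<lfloor>u\<rfloor> \<le> q"
    using assms by linarith+
  moreover have "\<lfloor>u + s\<rfloor> - \<lfloor>u\<rfloor> \<noteq> q"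
    using assms by linarith
  ultimately show False
    using zdvd_imp_le by fastforce
qed

text \<open>
  The circle is cut into \<open>q * k\<close> arcs of equal length, coloured cyclically; the bounds say that
  every edge spans between \<open>1\<close> and \<open>q - 1\<close> arcs.
\<close>

lemma colorable_distance_graph:
  fixes q k :: nat and \<alpha> \<epsilon> :: real
  assumes X: "X \<subseteq> circle"
    and lower: "1 \<le> (\<alpha> - \<epsilon>) * (q * k) / (2 * pi)"
    and upper: "(\<alpha> + \<epsilon>) * (q * k) / (2 * pi) \<le> real q - 1"
  shows "colorable (distance_graph \<alpha> X \<epsilon>) q"
proof -
  \<comment> \<open>\<open>h\<close> is the position on the circle in units of one arc; a full turn
    has length \<open>q * k\<close>.\<close>
  define h where "h x = Arg x * (q * k) / (2 * pi)" for x
  define c where "c x = nat (\<lfloor>h x\<rfloor> mod q)" for x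
  have q: "q > 0"
    using lower by (cases q) auto
  have "c x \<noteq> c y"
    if x: "x \<in> X" and y: "y \<in> X"
      and d: "\<alpha> - \<epsilon> \<le> geodesic_dist x y" "geodesic_dist x y \<le> \<alpha> + \<epsilon>" for x y
  proof
    assume "c x = c y"
    then have hxy: "\<lfloor>h x\<rfloor> mod q = \<lfloor>h y\<rfloor> mod q"
      using q unfolding c_def by (subst (asm) nat_eq_iff2) auto
    obtain t where t: "y = x * cis t" "\<bar>t\<bar> = geodesic_dist x y"
      using X x y circle_eq_mult_cis by blast
    have "cis (Arg x + t) = cis (Arg y)"
      using t(1) X x y by (metis cis_Arg_circle cis_mult subsetD)
    then have "sin (Arg x + t) = sin (Arg y)" "cos (Arg x + t) = cos (Arg y)"
      by (auto simp: complex_eq_iff)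
    then obtain n where n: "Arg y = Arg x + t + 2 * pi * of_int n"
      by (metis sin_cos_eq_iff mult.commute)
    define s where "s = \<bar>t\<bar> * (q * k) / (2 * pi)"
    have s: "1 \<le> s" "s \<le> of_int (int q) - 1"
    proof -
      have "(\<alpha> - \<epsilon>) * (q * k) / (2 * pi) \<le> s" "s \<le> (\<alpha> + \<epsilon>) * (q * k) / (2 * pi)"
        unfolding s_def using t(2) d
        by (auto intro!: divide_right_mono mult_right_mono)
      then show "1 \<le> s" "s \<le> of_int (int q) - 1" using lower upper by linarith+
    qed
    \<comment> \<open>The jump of \<open>Arg\<close> at its branch cut shifts \<open>h\<close> by a
      multiple of \<open>q * k\<close>, which the colour modulo \<open>q\<close> does not
      see.\<close>
    have "h y = h x + t * (q * k) / (2 * pi) + of_int (q * (k * n))"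
      unfolding h_def n by (simp add: field_simps)
    then have "\<lfloor>h y\<rfloor> = \<lfloor>h x + t * (q * k) / (2 * pi)\<rfloor> + q * (k * n)"
      by (metis floor_add_int)
    then have "\<lfloor>h x\<rfloor> mod q = \<lfloor>h x + t * (q * k) / (2 * pi)\<rfloor> mod q"
      using hxy by simp
    \<comment> \<open>The edge spans \<open>s\<close> arcs. For \<open>t < 0\<close> the comparison
      starts at \<open>h x - s\<close>, the position of \<open>y\<close> up to full turns.\<close>
    then show False
      using floor_mod_neq[OF s, of "h x"] floor_mod_neq[OF s, of "h x - s"]
      by (cases "t \<ge> 0") (auto simp: s_def)
  qed
  moreover have "c x < q" for x
    using q unfolding c_def by (simp add: nat_less_iff)
  ultimately show ?thesis
    unfolding colorable_def distance_graph_def by auto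
qed

lemma colorable_mono:
  assumes "colorable G j" "j \<le> k"
  shows "colorable G k"
  using assms unfolding colorable_def by (meson lessThan_subset_iff order_trans)

lemma chromatic_number_eqI:
  assumes "colorable G (Suc k)" "\<not> colorable G k"
  shows "chromatic_number G = enat (Suc k)"
  unfolding chromatic_number_def
proof (rule antisym)
  show "(INF j\<in>{j. colorable G j}. enat j) \<le> enat (Suc k)"
    using assms by (intro INF_lower) auto
  show "enat (Suc k) \<le> (INF j\<in>{j. colorable G j}. enat j)"
  proof (rule INF_greatest)
    fix j assume "j \<in> {j. colorable G j}"
    then have "\<not> j \<le> k" using assms colorable_mono by blast
    then show "enat (Suc k) \<le> enat j" by simp
  qed
qed

section \<open>Realizations and connectivity\<close>

text \<open>The point set underlying \<open>geometric_realization\<close>. Separating it from the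
  topology allows continuity and paths to be treated with \<open>continuous_on\<close> and
  \<open>path_component\<close>.\<close>

definition realization :: "'a set set \<Rightarrow> ('a \<Rightarrow> real) set" where
  "realization K =
     {f. (\<forall>v. 0 \<le> f v) \<and> {v. f v \<noteq> 0} \<in> K \<and> (\<Sum>v\<in>{v. f v \<noteq> 0}. f v) = 1}"

lemma geometric_realization_eq: "geometric_realization K = top_of_set (realization K)"
  by (simp add: geometric_realization_def realization_def euclidean_product_topology)

text \<open>Coordinates outside the support vanish, so the sum may run over any finite set
  \<open>V\<close> that contains the support.\<close>

lemma realizationI:
  assumes "\<And>v. 0 \<le> f v" "{v. f v \<noteq> 0} \<in> K" "{v. f v \<noteq> 0} \<subseteq> V" "finite V" "sum f V = 1"
  shows "f \<in> realization K"
proof -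
  have "sum f V = (\<Sum>v\<in>{v. f v \<noteq> 0}. f v)"
    using assms by (intro sum.mono_neutral_right) auto
  then show ?thesis using assms by (simp add: realization_def)
qed

lemma realizationD:
  assumes "f \<in> realization K"
  shows "0 \<le> f v" "{v. f v \<noteq> 0} \<in> K"
    and "finite V \<Longrightarrow> {v. f v \<noteq> 0} \<subseteq> V \<Longrightarrow> sum f V = 1"
proof -
  show "0 \<le> f v" "{v. f v \<noteq> 0} \<in> K" using assms by (auto simp: realization_def)
  assume "finite V" "{v. f v \<noteq> 0} \<subseteq> V"
  then have "sum f V = (\<Sum>v\<in>{v. f v \<noteq> 0}. f v)"
    by (intro sum.mono_neutral_right) auto
  then show "sum f V = 1" using assms by (simp add: realization_def)
qed

lemma continuous_on_coordinate: "continuous_on S (\<lambda>f. f v)"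
  by (rule continuous_on_subset[OF continuous_on_product_coordinates]) simp

text \<open>Both points lie in the closed simplex spanned by \<open>A\<close>, which is convex, so
  the straight segment between them stays in it. Its interior points may have a smaller support than
  \<open>A\<close>, hence the closure under subsets.\<close>

lemma path_component_realization_segment:
  assumes f: "f \<in> realization K" and g: "g \<in> realization K"
    and A: "A \<in> K" "finite A" "{v. f v \<noteq> 0} \<subseteq> A" "{v. g v \<noteq> 0} \<subseteq> A"
    and down: "\<And>B. B \<subseteq> A \<Longrightarrow> B \<in> K"
  shows "path_component (realization K) f g"
proof -
  define \<gamma> where "\<gamma> t v = (1 - t) * f v + t * g v" for t v
  have "continuous_on {0..1} \<gamma>"
    unfolding \<gamma>_def by (intro continuous_on_coordinatewise_then_product continuous_intros)
  moreover have "\<gamma> t \<in> realization K" if t: "t \<in> {0..1}" for t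
  proof (rule realizationI[of _ _ A])
    show "0 \<le> \<gamma> t v" for v
      unfolding \<gamma>_def using t realizationD(1)[OF f] realizationD(1)[OF g] by simp
    show sub: "{v. \<gamma> t v \<noteq> 0} \<subseteq> A"
    proof
      fix v assume "v \<in> {v. \<gamma> t v \<noteq> 0}"
      then have "f v \<noteq> 0 \<or> g v \<noteq> 0" by (auto simp: \<gamma>_def)
      then show "v \<in> A" using A(3,4) by blast
    qed
    then show "{v. \<gamma> t v \<noteq> 0} \<in> K" by (rule down)
    show "finite A" by fact
    have "sum (\<gamma> t) A = (1 - t) * sum f A + t * sum g A"
      unfolding \<gamma>_def by (simp add: sum.distrib sum_distrib_left)
    then show "sum (\<gamma> t) A = 1"
      using realizationD(3)[OF f A(2,3)] realizationD(3)[OF g A(2,4)] by simp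
  qed
  ultimately show ?thesis
    unfolding path_component_def
    by (intro exI[of _ \<gamma>]) (auto simp: path_def pathstart_def pathfinish_def path_image_def \<gamma>_def)
qed

text \<open>A sphere in \<open>Z\<close> is sent to \<open>Y\<close> by \<open>q\<close>, filled
  there, and the filling is brought back by \<open>p\<close>; on the boundary
  \<open>p \<circ> q\<close> is the identity.\<close>

lemma k_connected_retract:
  assumes "k_connected k Y" "continuous_map Y Z p" "continuous_map Z Y q"
    and pq: "\<And>z. z \<in> topspace Z \<Longrightarrow> p (q z) = z"
  shows "k_connected k Z"
  unfolding k_connected_def
proof (intro conjI allI impI)
  show "topspace Z \<noteq> {}"
  proof -
    obtain y where "y \<in> topspace Y" using assms(1) unfolding k_connected_def by blast
    then have "p y \<in> topspace Z" using assms(2) by (auto simp: continuous_map_def)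
    then show ?thesis by blast
  qed
  fix l f assume l: "int l \<le> k" and f: "continuous_map (nsphere l) Z f"
  then have "continuous_map (nsphere l) Y (q \<circ> f)"
    using assms(3) continuous_map_compose by blast
  then obtain g where g: "continuous_map (nball (Suc l)) Y g"
      "\<forall>x\<in>topspace (nsphere l). g x = (q \<circ> f) x"
    using assms(1) l unfolding k_connected_def by blast
  have "continuous_map (nball (Suc l)) Z (p \<circ> g)"
    using g(1) assms(2) continuous_map_compose by blast
  moreover have "(p \<circ> g) x = f x" if "x \<in> topspace (nsphere l)" for x
  proof -
    have "f x \<in> topspace Z" using f that unfolding continuous_map_def by blast
    then show ?thesis using g(2) pq that by simp
  qed
  ultimately show "\<exists>g. continuous_map (nball (Suc l)) Z g \<and> (\<forall>x\<in>topspace (nsphere l). g x = f x)"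
    by blast
qed

lemma k_connected_mono: "k_connected k Y \<Longrightarrow> j \<le> k \<Longrightarrow> k_connected j Y"
  unfolding k_connected_def by (meson order_trans)

lemma conn_eq_0I:
  assumes "k_connected 0 Y" "\<not> k_connected 1 Y"
  shows "conn Y = 0"
  unfolding conn_def
proof (rule antisym)
  have "k \<le> 0" if "k_connected k Y" for k
    using that assms(2) k_connected_mono[of k Y 1] by force
  then show "(SUP k\<in>{k. -1 \<le> k \<and> k_connected k Y}. ereal (of_int k)) \<le> 0"
    by (intro SUP_least) (auto simp: zero_ereal_def)
  show "0 \<le> (SUP k\<in>{k. -1 \<le> k \<and> k_connected k Y}. ereal (of_int k))"
    using assms(1) by (intro SUP_upper2[of 0]) (auto simp: zero_ereal_def)
qed

section \<open>Spheres and balls of dimension at most two\<close>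

lemma nsphere_eq: "nsphere l = top_of_set {x. (\<forall>i>l. x i = 0) \<and> (\<Sum>i\<le>l. x i ^ 2) = 1}"
  by (simp add: nsphere_def Euclidean_space_def subtopology_subtopology euclidean_product_topology
      Int_def Suc_le_eq)

lemma nball_eq: "nball l = top_of_set {x. (\<forall>i\<ge>l. x i = 0) \<and> (\<Sum>i<l. x i ^ 2) \<le> 1}"
  by (simp add: nball_def Euclidean_space_def subtopology_subtopology euclidean_product_topology
      Int_def)

text \<open>The 0-sphere consists of the points with first coordinate 1 and -1, and the 1-ball is
  the interval between them. A path joining the two images, reparametrized from [0, 1] to [-1, 1],
  is the required extension.\<close>

lemma k_connected_0_if_path_connected:
  assumes "R \<noteq> {}" "path_connected R"
  shows "k_connected 0 (top_of_set R)"
  unfolding k_connected_def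
proof (intro conjI allI impI)
  show "topspace (top_of_set R) \<noteq> {}" using assms by simp
  fix l :: nat and f :: "(nat \<Rightarrow> real) \<Rightarrow> 'a"
  assume "int l \<le> 0" and f: "continuous_map (nsphere l) (top_of_set R) f"
  then have [simp]: "l = 0" by simp
  define e where "e s = (\<lambda>i::nat. if i = 0 then s else 0 :: real)" for s
  have e: "e 1 \<in> topspace (nsphere 0)" "e (-1) \<in> topspace (nsphere 0)"
    by (auto simp: nsphere_eq e_def)
  have ecases: "x = e 1 \<or> x = e (-1)" if "x \<in> topspace (nsphere 0)" for x
    using that by (auto simp: nsphere_eq e_def fun_eq_iff power2_eq_1_iff)
  obtain \<gamma> where \<gamma>: "path \<gamma>" "path_image \<gamma> \<subseteq> R" "pathstart \<gamma> = f (e (-1))" "pathfinish \<gamma> = f (e 1)"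
  proof -
    have "f ` topspace (nsphere 0) \<subseteq> R"
      using f by (auto simp: continuous_map_def)
    then have "f (e (-1)) \<in> R" "f (e 1) \<in> R" using e by blast+
    then show ?thesis using assms(2) that unfolding path_connected_def by blast
  qed
  define g where "g x = \<gamma> ((x 0 + 1) / 2)" for x :: "nat \<Rightarrow> real"
  have unit: "(x 0 + 1) / 2 \<in> {0..1}" if "x \<in> topspace (nball 1)" for x
  proof -
    have "(x 0)\<^sup>2 \<le> 1" using that by (simp add: nball_eq)
    then have "\<bar>x 0\<bar> \<le> 1" by (simp add: abs_square_le_1)
    then show ?thesis by auto
  qed
  have "continuous_on (topspace (nball 1)) g"
    unfolding g_def
    by (rule continuous_on_compose2[OF \<gamma>(1)[unfolded path_def]])
      (use unit in \<open>auto intro!: continuous_intros continuous_on_coordinate\<close>)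
  moreover have "g ` topspace (nball 1) \<subseteq> R"
    using unit \<gamma>(2) unfolding g_def path_image_def by blast
  ultimately have "continuous_map (nball (Suc l)) (top_of_set R) g"
    by (auto simp: nball_eq)
  moreover have "g x = f x" if "x \<in> topspace (nsphere l)" for x
    using ecases[of x] that \<gamma>(3,4)
    by (auto simp: g_def pathstart_def pathfinish_def) (auto simp: e_def)
  ultimately show "\<exists>g. continuous_map (nball (Suc l)) (top_of_set R) g \<and>
      (\<forall>x\<in>topspace (nsphere l). g x = f x)"
    by blast
qed

text \<open>This moves the lifting property from spheres and balls of real sequences to the unit
  circle and disc in the complex plane, where continuous logarithms are available.\<close>

lemma k_connected_1_extends_to_disc:
  assumes "k_connected 1 (top_of_set R)"
    and L: "continuous_on circle L" "L ` circle \<subseteq> R"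
  obtains g where "continuous_on (cball 0 1) g" "g ` cball 0 1 \<subseteq> R" "\<And>y. y \<in> circle \<Longrightarrow> g y = L y"
proof -
  \<comment> \<open>\<open>c\<close> keeps the first two coordinates and \<open>p\<close> pads with
    zeros, so \<open>c \<circ> p\<close> is the identity of the plane.\<close>
  define c where "c x = Complex (x 0) (x (Suc 0))" for x :: "nat \<Rightarrow> real"
  define p where "p z i = (if i = 0 then Re z else if i = Suc 0 then Im z else 0)" for z and i :: nat
  have c: "continuous_on S c" for S
    unfolding c_def Complex_eq by (intro continuous_intros continuous_on_coordinate)
  have p: "continuous_on S p" for S
    unfolding p_def
  proof (rule continuous_on_coordinatewise_then_product)
    show "continuous_on S (\<lambda>z. if i = 0 then Re z else if i = Suc 0 then Im z else 0)" for i :: nat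
      by (cases "i = 0"; cases "i = Suc 0") (auto intro!: continuous_intros)
  qed
  have cp: "c (p z) = z" for z
    by (simp add: c_def p_def)
  have norm_c: "(cmod (c x))\<^sup>2 = (\<Sum>i\<le>1. x i ^ 2)" for x
    by (simp add: c_def cmod_power2)
  have "continuous_map (nsphere 1) (top_of_set R) (L \<circ> c)"
  proof -
    have "c ` topspace (nsphere 1) \<subseteq> circle"
    proof (rule image_subsetI)
      fix x assume "x \<in> topspace (nsphere 1)"
      then have "(cmod (c x))\<^sup>2 = 1" unfolding norm_c by (simp add: nsphere_eq)
      then show "c x \<in> circle" by (simp add: abs_square_eq_1)
    qed
    then have "continuous_on (topspace (nsphere 1)) (L \<circ> c)" "(L \<circ> c) ` topspace (nsphere 1) \<subseteq> R"
      using continuous_on_compose[OF c continuous_on_subset[OF L(1)]] L(2) by force+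
    then show ?thesis unfolding nsphere_eq by auto
  qed
  then obtain h where h: "continuous_map (nball (Suc 1)) (top_of_set R) h"
      "\<forall>x\<in>topspace (nsphere 1). h x = (L \<circ> c) x"
    using assms(1)[unfolded k_connected_def, THEN conjunct2, rule_format, of 1 "L \<circ> c"]
    by (metis of_nat_1 order_refl)
  have pball: "p ` cball 0 1 \<subseteq> topspace (nball (Suc 1))"
  proof (rule image_subsetI)
    fix z :: complex assume "z \<in> cball 0 1"
    then have "(cmod z)\<^sup>2 \<le> 1" by (simp add: abs_square_le_1)
    then show "p z \<in> topspace (nball (Suc 1))"
      by (auto simp: nball_eq p_def cmod_power2)
  qed
  have pcirc: "p y \<in> topspace (nsphere 1)" if "y \<in> circle" for y
  proof -
    have "(cmod y)\<^sup>2 = 1" using that by simp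
    then show ?thesis by (auto simp: nsphere_eq p_def cmod_power2)
  qed
  show ?thesis
  proof (rule that[of "h \<circ> p"])
    have h': "continuous_on (topspace (nball (Suc 1))) h" "h ` topspace (nball (Suc 1)) \<subseteq> R"
      using h(1) unfolding nball_eq by auto
    show "continuous_on (cball 0 1) (h \<circ> p)"
      by (rule continuous_on_compose[OF p continuous_on_subset[OF h'(1) pball]])
    show "(h \<circ> p) ` cball 0 1 \<subseteq> R"
      using h'(2) pball by (simp only: image_comp[symmetric]) blast
    show "(h \<circ> p) y = L y" if "y \<in> circle" for y
      using h(2) pcirc[OF that] cp by simp
  qed
qed

text \<open>The curve \<open>y ^ d\<close> winds \<open>d\<close> times around 0, whereas a
  continuous logarithm forces winding number 0. The difference \<open>f\<close> of the two
  logarithms along \<open>cis t\<close> takes values in the multiples of 2 pi i, so it is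
  constant.\<close>

lemma no_continuous_logarithm_power:
  assumes "continuous_on circle k" "\<And>y. y \<in> circle \<Longrightarrow> y ^ d = exp (k y)"
  shows "d = 0"
proof -
  define f where "f t = k (cis t) - \<i> * of_real (real d * t)" for t
  have cont: "continuous_on {0..2 * pi} f"
    unfolding f_def
    by (intro continuous_intros continuous_on_compose2[OF assms(1)] continuous_on_cis) auto
  have ex: "exp (f t) = 1" for t
  proof -
    have "exp (k (cis t)) = exp (\<i> * of_real (real d * t))"
      using assms(2)[OF cis_in_circle, of t] unfolding Complex.DeMoivre cis_conv_exp[of "real d * t"]
      by (rule sym)
    then show ?thesis unfolding f_def exp_diff by simp
  qed
  \<comment> \<open>Distinct values of \<open>f\<close> are at least 2 pi apart, and a continuous
    function with discrete range on an interval is constant.\<close>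
  have "f constant_on {0..2 * pi}"
  proof (rule continuous_discrete_range_constant[OF _ cont])
    fix t :: real
    show "\<exists>e>0. \<forall>u. u \<in> {0..2 * pi} \<and> f u \<noteq> f t \<longrightarrow> e \<le> norm (f u - f t)"
    proof (intro exI[of _ "2 * pi"] conjI allI impI)
      fix u assume u: "u \<in> {0..2 * pi} \<and> f u \<noteq> f t"
      have "exp (f u) = exp (f t)" using ex by simp
      then obtain n :: int where n: "f u = f t + of_int (2 * n) * pi * \<i>"
        using exp_eq by auto
      then have "n \<noteq> 0" using u by auto
      then have "1 \<le> \<bar>real_of_int n\<bar>" by linarith
      moreover have "norm (f u - f t) = 2 * pi * \<bar>real_of_int n\<bar>"
        using n by (simp add: norm_mult)
      ultimately show "2 * pi \<le> norm (f u - f t)" by simp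
    qed simp
  qed simp
  \<comment> \<open>The terms in \<open>k\<close> agree because \<open>cis 0 = cis (2 * pi)\<close>;
    what remains is 2 pi i times \<open>d\<close>.\<close>
  then have "f 0 = f (2 * pi)"
    by (force simp: constant_on_def)
  then show "d = 0" by (simp add: f_def)
qed

section \<open>Vertex powers and their affine extension\<close>

lemma neighborhood_complex_downward_closed:
  "A \<in> neighborhood_complex G \<Longrightarrow> B \<subseteq> A \<Longrightarrow> B \<in> neighborhood_complex G"
  unfolding neighborhood_complex_def using finite_subset by fastforce

text \<open>Multiplication by \<open>cnj (y ^ d)\<close> rotates \<open>y ^ d\<close> to 1, which
  leaves only the angle relative to \<open>y\<close>, multiplied by \<open>d\<close>.\<close>

lemma power_mult_cis_cnj:
  assumes "y \<in> circle"
  shows "(y * cis t) ^ d * cnj (y ^ d) = cis (d * t)"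
proof -
  have "y ^ d * cnj (y ^ d) = 1"
    using assms by (simp only: complex_norm_square[symmetric]) (simp add: norm_power)
  then show ?thesis
    by (simp add: power_mult_distrib Complex.DeMoivre mult.commute mult.left_commute)
qed

text \<open>The extension of the vertex map \<open>v \<mapsto> v ^ d\<close> to the realization that
  is affine on each simplex.\<close>

definition power_sum :: "complex set \<Rightarrow> nat \<Rightarrow> (complex \<Rightarrow> real) \<Rightarrow> complex" where
  "power_sum X d f = (\<Sum>v\<in>X. of_real (f v) * v ^ d)"

lemma continuous_on_power_sum: "continuous_on S (power_sum X d)"
  unfolding power_sum_def by (intro continuous_intros continuous_on_coordinate)

text \<open>An open half plane is convex, so it contains a convex combination of the vertex images
  as soon as it contains each of them. The factor \<open>\<sigma>\<close> allows either side of the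
  line orthogonal to \<open>w\<close>.\<close>

lemma power_sum_in_half_plane:
  assumes f: "f \<in> realization K" and X: "finite X" "{v. f v \<noteq> 0} \<subseteq> X"
    and pos: "\<And>v. f v \<noteq> 0 \<Longrightarrow> 0 < \<sigma> * Re (v ^ d * cnj w)"
  shows "0 < \<sigma> * Re (power_sum X d f * cnj w)"
proof -
  have "\<sigma> * Re (power_sum X d f * cnj w) = (\<Sum>v\<in>X. f v * (\<sigma> * Re (v ^ d * cnj w)))"
    unfolding power_sum_def sum_distrib_right sum_distrib_left Re_sum
    by (intro sum.cong) (simp_all add: algebra_simps)
  also have "\<dots> > 0"
  proof -
    have "sum f X = 1" using realizationD(3)[OF f X] .
    then obtain v where v: "v \<in> X" "f v \<noteq> 0"
      using sum.neutral[of X f] by fastforce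
    have nonneg: "0 \<le> f u * (\<sigma> * Re (u ^ d * cnj w))" for u
      using pos[of u] realizationD(1)[OF f, of u] by (cases "f u = 0") auto
    have "0 < f v" using v(2) realizationD(1)[OF f, of v] by simp
    then have "0 < f v * (\<sigma> * Re (v ^ d * cnj w))"
      using pos[OF v(2)] by (rule mult_pos_pos)
    then show ?thesis
      using nonneg v(1) X(1) by (intro sum_pos2[of X v]) auto
  qed
  finally show ?thesis .
qed

section \<open>Distance graphs on a net\<close>

text \<open>The deterministic core: randomness enters only through the net property, and the claims
  are proved for every finite net with a small enough \<epsilon>.\<close>

locale dense_distance_graph =
  fixes \<alpha> \<epsilon> :: real and X :: "complex set"
  assumes finite_X: "finite X"
    and net: "circle_net (\<epsilon> / 4) X"
    and alpha: "0 < \<alpha>" "\<alpha> \<le> pi"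
    and eps: "0 < \<epsilon>" "\<epsilon> < \<alpha>"
begin

abbreviation "G \<equiv> distance_graph \<alpha> X \<epsilon>"

lemma X_in_circle: "v \<in> X \<Longrightarrow> v \<in> circle"
  using net unfolding circle_net_def by blast

lemma netE:
  assumes "y \<in> circle"
  obtains v where "v \<in> X" "geodesic_dist y v \<le> \<epsilon> / 4"
  using assms net unfolding circle_net_def by blast

lemma verts_G [simp]: "verts G = X"
  by (simp add: distance_graph_def)

text \<open>Since \<epsilon> < \<alpha>, a point is too close to itself to satisfy the distance
  condition, so the condition that the points differ is automatic.\<close>

lemma adj_G: "v \<in> X \<Longrightarrow> adj G v z \<longleftrightarrow> \<bar>geodesic_dist v z - \<alpha>\<bar> \<le> \<epsilon>"
  using geodesic_dist_self[OF X_in_circle, of v] eps alpha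
  by (auto simp: distance_graph_def)

text \<open>The errors 3 \<epsilon> / 4 at one end and \<epsilon> / 4 at the other add up to the
  tolerance \<epsilon> of an edge.\<close>

lemma adj_shift:
  assumes "y \<in> circle" "v \<in> X" "z \<in> X" "\<bar>s\<bar> = \<alpha>"
    and "geodesic_dist y v \<le> 3 * \<epsilon> / 4" "geodesic_dist (y * cis s) z \<le> \<epsilon> / 4"
  shows "adj G v z"
  using geodesic_dist_mult_cis_near[OF assms(1) X_in_circle X_in_circle _ _ assms(4),
      OF assms(2,3), of \<epsilon>] assms eps alpha adj_G by simp

lemma shiftE:
  assumes "y \<in> circle" "\<bar>s\<bar> = \<alpha>"
  obtains z where "z \<in> X" "geodesic_dist (y * cis s) z \<le> \<epsilon> / 4"
    "\<And>v. v \<in> X \<Longrightarrow> geodesic_dist y v \<le> 3 * \<epsilon> / 4 \<Longrightarrow> adj G v z"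
  using netE[OF mult_cis_in_circle[OF assms(1)]] adj_shift[OF assms(1) _ _ assms(2)] by metis

lemma close_points_simplex:
  assumes "y \<in> circle" "A \<subseteq> X" "\<And>v. v \<in> A \<Longrightarrow> geodesic_dist y v \<le> 3 * \<epsilon> / 4"
  shows "A \<in> neighborhood_complex G"
proof -
  obtain z where "z \<in> X" "\<And>v. v \<in> X \<Longrightarrow> geodesic_dist y v \<le> 3 * \<epsilon> / 4 \<Longrightarrow> adj G v z"
    using shiftE[OF assms(1), of \<alpha>] alpha by auto
  then have "z \<in> (\<Inter>v\<in>A. neighbors G v)"
    using assms unfolding neighbors_def by auto
  then show ?thesis
    using assms finite_X finite_subset unfolding neighborhood_complex_def by auto
qed

section \<open>Lower bounds for the chromatic number\<close>

lemma not_colorable_if_locally_constant: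
  assumes "\<And>c y u v. \<lbrakk>c ` X \<subseteq> {..<k}; \<forall>v\<in>X. \<forall>w\<in>X. adj G v w \<longrightarrow> c v \<noteq> c w; y \<in> circle; u \<in> X; v \<in> X;
      geodesic_dist y u \<le> \<epsilon> / 4; geodesic_dist y v \<le> \<epsilon> / 4\<rbrakk> \<Longrightarrow> c u = (c v :: nat)"
  shows "\<not> colorable G k"
proof
  assume "colorable G k"
  then obtain c where c: "c ` X \<subseteq> {..<k}" "\<forall>v\<in>X. \<forall>w\<in>X. adj G v w \<longrightarrow> c v \<noteq> c w"
    unfolding colorable_def by auto
  have one: "1 \<in> circle" by simp
  obtain v where v: "v \<in> X" "geodesic_dist 1 v \<le> \<epsilon> / 4" using netE[OF one] .
  obtain z where z: "z \<in> X" "\<And>v. v \<in> X \<Longrightarrow> geodesic_dist 1 v \<le> 3 * \<epsilon> / 4 \<Longrightarrow> adj G v z"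
    using shiftE[OF one, of \<alpha>] alpha by auto
  \<comment> \<open>Local constancy makes \<open>c\<close> constant on all of \<open>X\<close>, but
    \<open>v\<close> near 1 and \<open>z\<close> near \<open>cis \<alpha>\<close> form an
    edge.\<close>
  have "c v = c z"
    using constant_on_net[OF finite_X net, of c, OF _ v(1) z(1)] assms[OF c] by metis
  moreover have "adj G v z" using v eps by (intro z(2)) auto
  ultimately show False using c(2) v(1) z(1) by blast
qed

lemma not_colorable_2: "\<not> colorable G 2"
proof (rule not_colorable_if_locally_constant)
  fix c :: "complex \<Rightarrow> nat" and y u v
  assume c: "c ` X \<subseteq> {..<2}" "\<forall>v\<in>X. \<forall>w\<in>X. adj G v w \<longrightarrow> c v \<noteq> c w"
    and y: "y \<in> circle" "u \<in> X" "v \<in> X" "geodesic_dist y u \<le> \<epsilon> / 4" "geodesic_dist y v \<le> \<epsilon> / 4"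
  obtain z where z: "z \<in> X" "\<And>v. v \<in> X \<Longrightarrow> geodesic_dist y v \<le> 3 * \<epsilon> / 4 \<Longrightarrow> adj G v z"
    using shiftE[OF y(1), of \<alpha>] alpha by auto
  have "adj G u z" "adj G v z" using y eps by (auto intro!: z(2))
  then have "c u \<noteq> c z" "c v \<noteq> c z" using c(2) y z(1) by blast+
  moreover have "c u < 2" "c v < 2" "c z < 2" using c(1) y z(1) by blast+
  ultimately show "c u = c v" by linarith
qed

lemma not_colorable_3:
  assumes "\<alpha> = 2 * pi / 3"
  shows "\<not> colorable G 3"
proof (rule not_colorable_if_locally_constant)
  fix c :: "complex \<Rightarrow> nat" and y u v
  assume c: "c ` X \<subseteq> {..<3}" "\<forall>v\<in>X. \<forall>w\<in>X. adj G v w \<longrightarrow> c v \<noteq> c w"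
    and y: "y \<in> circle" "u \<in> X" "v \<in> X" "geodesic_dist y u \<le> \<epsilon> / 4" "geodesic_dist y v \<le> \<epsilon> / 4"
  obtain z where z: "z \<in> X" "geodesic_dist (y * cis \<alpha>) z \<le> \<epsilon> / 4"
    "\<And>v. v \<in> X \<Longrightarrow> geodesic_dist y v \<le> 3 * \<epsilon> / 4 \<Longrightarrow> adj G v z"
    using shiftE[OF y(1), of \<alpha>] alpha by auto
  obtain z' where z': "z' \<in> X" "geodesic_dist (y * cis (-\<alpha>)) z' \<le> \<epsilon> / 4"
    "\<And>v. v \<in> X \<Longrightarrow> geodesic_dist y v \<le> 3 * \<epsilon> / 4 \<Longrightarrow> adj G v z'"
    using shiftE[OF y(1), of "-\<alpha>"] alpha by auto
  \<comment> \<open>As 3 \<alpha> = 2 pi, rotating twice by \<alpha> is rotating once by -\<alpha>.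
    Hence \<open>z\<close> and \<open>z'\<close> are themselves at distance about \<alpha>.\<close>
  have "cis \<alpha> * cis \<alpha> = cis (2 * pi + (-\<alpha>))"
    unfolding cis_mult by (rule arg_cong[where f = cis]) (simp add: assms)
  also have "\<dots> = cis (-\<alpha>)" unfolding cis_mult[symmetric] by (simp only: cis_2pi mult_1)
  finally have "y * cis \<alpha> * cis \<alpha> = y * cis (-\<alpha>)" by (simp add: mult.assoc)
  then have "adj G z z'"
    using adj_shift[OF mult_cis_in_circle[OF y(1)] z(1) z'(1), of \<alpha> \<alpha>] z(2) z'(2) eps alpha
    by (simp only:)
  then have "c z \<noteq> c z'" using c(2) z(1) z'(1) by blast
  \<comment> \<open>Both \<open>u\<close> and \<open>v\<close> complete a triangle with the edge
    from \<open>z\<close> to \<open>z'\<close>, so both carry the one remaining colour.\<close>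
  moreover have "adj G u z" "adj G v z" "adj G u z'" "adj G v z'"
    using y eps by (auto intro!: z(3) z'(3))
  then have "c u \<noteq> c z" "c v \<noteq> c z" "c u \<noteq> c z'" "c v \<noteq> c z'"
    using c(2) y z(1) z'(1) by blast+
  moreover have "c u < 3" "c v < 3" "c z < 3" "c z' < 3" using c(1) y z(1) z'(1) by blast+
  ultimately show "c u = c v" by linarith
qed

section \<open>The loop in the neighborhood complex\<close>

definition bump :: "complex \<Rightarrow> complex \<Rightarrow> real" where
  "bump v y = max 0 (\<epsilon> / 2 - geodesic_dist y v)"

text \<open>A partition of unity read as barycentric coordinates. The radius \<epsilon> / 2 of the
  bumps exceeds \<epsilon> / 4, so at every point of the circle some bump is positive; it is below 3
  \<epsilon> / 4, so the vertices with a positive bump span a simplex.\<close>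

definition loop :: "complex \<Rightarrow> complex \<Rightarrow> real" where
  "loop y v = (if v \<in> X then bump v y / (\<Sum>u\<in>X. bump u y) else 0)"

lemma bump_nonneg: "0 \<le> bump v y"
  by (simp add: bump_def)

lemma sum_bump_pos:
  assumes "y \<in> circle"
  shows "0 < (\<Sum>u\<in>X. bump u y)"
proof -
  obtain v where v: "v \<in> X" "geodesic_dist y v \<le> \<epsilon> / 4" using netE[OF assms] .
  then have "0 < bump v y" using eps by (auto simp: bump_def)
  then show ?thesis using v(1) finite_X bump_nonneg by (intro sum_pos2[of X v]) auto
qed

lemma continuous_on_loop: "continuous_on circle loop"
proof (rule continuous_on_coordinatewise_then_product)
  fix v
  have "continuous_on circle (bump u)" if "u \<in> X" for u
    unfolding bump_def using X_in_circle[OF that]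
    by (intro continuous_intros continuous_on_geodesic_dist)
  then show "continuous_on circle (\<lambda>y. loop y v)"
    using sum_bump_pos unfolding loop_def
    by (cases "v \<in> X") (auto intro!: continuous_intros less_imp_neq[symmetric])
qed

lemma loop_support:
  assumes "y \<in> circle"
  shows "{v. loop y v \<noteq> 0} = {v \<in> X. geodesic_dist y v < \<epsilon> / 2}"
  using sum_bump_pos[OF assms] by (auto simp: loop_def bump_def)

lemma loop_in_realization:
  assumes "y \<in> circle"
  shows "loop y \<in> realization (neighborhood_complex G)"
proof (rule realizationI[of _ _ X])
  show "0 \<le> loop y v" for v
    using sum_bump_pos[OF assms] by (simp add: loop_def bump_nonneg)
  show "{v. loop y v \<noteq> 0} \<in> neighborhood_complex G"
    using eps by (intro close_points_simplex[OF assms]) (auto simp: loop_support[OF assms])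
  show "{v. loop y v \<noteq> 0} \<subseteq> X" by (auto simp: loop_support[OF assms])
  show "finite X" by (rule finite_X)
  have "(\<Sum>v\<in>X. loop y v) = (\<Sum>v\<in>X. bump v y) / (\<Sum>u\<in>X. bump u y)"
    unfolding sum_divide_distrib by (intro sum.cong) (simp_all add: loop_def)
  then show "sum (loop y) X = 1" using sum_bump_pos[OF assms] by simp
qed

lemma path_connected_realization: "path_connected (realization (neighborhood_complex G))"
  (is "path_connected ?R")
proof -
  have to_loop: "\<exists>v\<in>circle. path_component ?R f (loop v)" if f: "f \<in> ?R" for f
  proof -
    define A where "A = {v. f v \<noteq> 0}"
    have A: "A \<in> neighborhood_complex G" "finite A" "A \<subseteq> X"
      using realizationD(2)[OF f] by (auto simp: A_def neighborhood_complex_def)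
    have "A \<noteq> {}"
      using realizationD(3)[OF f A(2)] A_def by force
    then obtain v where v: "v \<in> A" by blast
    then have vX: "v \<in> X" and vc: "v \<in> circle" using A(3) X_in_circle by blast+
    \<comment> \<open>\<open>e\<close> is the vertex \<open>v\<close> as a point of the realization.
      It belongs to the simplex \<open>A\<close> of \<open>f\<close> and also to the simplex of
      \<open>loop v\<close>, so two segments lead from \<open>f\<close> to the loop.\<close>
    define e where "e u = (if u = v then 1 else 0 :: real)" for u
    have e_supp: "{u. e u \<noteq> 0} = {v}" by (auto simp: e_def)
    have e: "e \<in> ?R"
    proof (rule realizationI[of _ _ "{v}"])
      show "{u. e u \<noteq> 0} \<in> neighborhood_complex G"
        unfolding e_supp using v by (intro neighborhood_complex_downward_closed[OF A(1)]) simp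
    qed (auto simp: e_def)
    have "path_component ?R f e"
      using A v e_supp neighborhood_complex_downward_closed
      by (intro path_component_realization_segment[OF f e, of A]) (auto simp: A_def)
    moreover have "path_component ?R e (loop v)"
    proof (rule path_component_realization_segment[OF e loop_in_realization[OF vc]])
      show S: "{u. loop v u \<noteq> 0} \<in> neighborhood_complex G"
        using realizationD(2)[OF loop_in_realization[OF vc]] .
      show "finite {u. loop v u \<noteq> 0}"
        using S by (simp add: neighborhood_complex_def)
      show "{u. e u \<noteq> 0} \<subseteq> {u. loop v u \<noteq> 0}"
        unfolding e_supp loop_support[OF vc] using vX geodesic_dist_self[OF vc] eps by simp
      show "B \<in> neighborhood_complex G" if "B \<subseteq> {u. loop v u \<noteq> 0}" for B
        using S that by (rule neighborhood_complex_downward_closed)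
    qed simp
    ultimately show ?thesis using vc path_component_trans by blast
  qed
  have "path_connected (loop ` circle)"
    by (intro path_connected_continuous_image continuous_on_loop path_connected_sphere) simp
  moreover have "loop ` circle \<subseteq> ?R" using loop_in_realization by blast
  ultimately have "path_component ?R (loop y) (loop y')" if "y \<in> circle" "y' \<in> circle" for y y'
    using that unfolding path_connected_component by (meson image_eqI path_component_of_subset)
  then show ?thesis
    unfolding path_connected_component
    using to_loop path_component_trans path_component_sym by metis
qed

section \<open>The loop does not bound a disc\<close>

lemma power_sum_nonzero:
  fixes d :: nat and m :: int
  assumes d: "\<bar>d * \<alpha> - m * pi\<bar> < pi / 3" "d * \<epsilon> < pi / 6"
    and f: "f \<in> realization (neighborhood_complex G)"
  shows "power_sum X d f \<noteq> 0"
proof -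
  have A: "{v. f v \<noteq> 0} \<in> neighborhood_complex G" using realizationD(2)[OF f] .
  then have sub: "{v. f v \<noteq> 0} \<subseteq> X" by (simp add: neighborhood_complex_def)
  obtain z where "z \<in> (\<Inter>v\<in>{v. f v \<noteq> 0}. neighbors G v)"
    using A unfolding neighborhood_complex_def by blast
  then have zn: "z \<in> X \<and> adj G v z" if "f v \<noteq> 0" for v
    using that by (auto simp: neighbors_def)
  \<comment> \<open>Angles are measured from the common neighbour \<open>z\<close>. The sign
    \<open>cos (m * pi)\<close> selects the half plane around \<open>z ^ d\<close> or around its
    negative.\<close>
  have "0 < cos (m * pi) * Re (power_sum X d f * cnj (z ^ d))"
  proof (rule power_sum_in_half_plane[OF f finite_X sub])
    fix v assume v: "f v \<noteq> 0"
    have vX: "v \<in> X" using sub v by blast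
    have zX: "z \<in> X" and ad: "adj G v z" using zn[OF v] by auto
    obtain t where t: "v = z * cis t" "\<bar>t\<bar> = geodesic_dist z v"
      using circle_eq_mult_cis[OF X_in_circle[OF zX] X_in_circle[OF vX]] .
    have "\<bar>\<bar>t\<bar> - \<alpha>\<bar> \<le> \<epsilon>"
      using ad adj_G[OF vX] t(2) by (simp add: geodesic_dist_commute)
    then have "\<bar>d * \<bar>t\<bar> - d * \<alpha>\<bar> \<le> d * \<epsilon>"
      by (simp add: abs_mult mult_left_mono flip: right_diff_distrib)
    \<comment> \<open>The two errors combine to less than pi / 3 + pi / 6 = pi / 2.\<close>
    then have "\<bar>d * \<bar>t\<bar> - m * pi\<bar> < pi / 2" using d by linarith
    then have "0 < cos (d * \<bar>t\<bar> - m * pi)" by (intro cos_gt_zero_pi) linarith+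
    \<comment> \<open>Vertices on both sides of \<open>z\<close> behave alike: cosine is even, and
      the sine term vanishes at \<open>m * pi\<close>.\<close>
    also have "\<dots> = cos (d * t) * cos (m * pi)"
      by (cases "t \<ge> 0") (simp_all add: cos_diff sin_int_times_real mult.commute)
    finally show "0 < cos (m * pi) * Re (v ^ d * cnj (z ^ d))"
      unfolding t(1) power_mult_cis_cnj[OF X_in_circle[OF zX]] by (simp add: mult.commute)
  qed
  then show ?thesis by auto
qed

text \<open>On a disc filling the loop, the nonvanishing map \<open>power_sum X d\<close> would have
  a continuous logarithm. On the circle this map is \<open>y ^ d\<close> times a factor with
  positive real part, so \<open>y ^ d\<close> would have one as well.\<close>

lemma not_1_connected:
  fixes d :: nat and m :: int
  assumes d: "0 < d" "\<bar>d * \<alpha> - m * pi\<bar> < pi / 3" "d * \<epsilon> < pi / 6"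
  shows "\<not> k_connected 1 (top_of_set (realization (neighborhood_complex G)))"
    (is "\<not> k_connected 1 (top_of_set ?R)")
proof
  assume "k_connected 1 (top_of_set ?R)"
  moreover have "loop ` circle \<subseteq> ?R" using loop_in_realization by blast
  ultimately obtain g where g: "continuous_on (cball 0 1) g" "g ` cball 0 1 \<subseteq> ?R"
      "\<And>y. y \<in> circle \<Longrightarrow> g y = loop y"
    using k_connected_1_extends_to_disc[OF _ continuous_on_loop] by metis
  let ?F = "power_sum X d"
  have "continuous_on (cball 0 1) (?F \<circ> g)"
    using g(1) continuous_on_power_sum by (rule continuous_on_compose)
  moreover have "(?F \<circ> g) z \<noteq> 0" if "z \<in> cball 0 1" for z
  proof -
    have "g z \<in> ?R" using g(2) that by blast
    then show ?thesis using power_sum_nonzero[OF d(2,3)] by simp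
  qed
  ultimately obtain h where h: "continuous_on (cball 0 1) h"
      "\<And>z. z \<in> cball 0 1 \<Longrightarrow> (?F \<circ> g) z = exp (h z)"
    using continuous_logarithm_on_cball by metis
  \<comment> \<open>As \<open>y ^ d\<close> has modulus 1, \<open>u\<close> is the quotient of the
    power sum by \<open>y ^ d\<close>. Its positive real part makes the principal logarithm
    \<open>Ln\<close> continuous along it.\<close>
  define u where "u y = ?F (loop y) * cnj (y ^ d)" for y
  have u_pos: "0 < Re (u y)" if y: "y \<in> circle" for y
  proof -
    have "0 < 1 * Re (?F (loop y) * cnj (y ^ d))"
    proof (rule power_sum_in_half_plane[OF loop_in_realization[OF y] finite_X])
      show "{v. loop y v \<noteq> 0} \<subseteq> X" using loop_support[OF y] by auto
      fix v assume "loop y v \<noteq> 0"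
      then have v: "v \<in> X" "geodesic_dist y v < \<epsilon> / 2" using loop_support[OF y] by auto
      obtain t where t: "v = y * cis t" "\<bar>t\<bar> = geodesic_dist y v"
        using circle_eq_mult_cis[OF y X_in_circle[OF v(1)]] .
      \<comment> \<open>The \<open>d\<close>-th powers of the vertices near \<open>y\<close> deviate
        from \<open>y ^ d\<close> by an angle below pi / 6.\<close>
      have "\<bar>d * t\<bar> \<le> d * \<epsilon>"
        using t(2) v(2) eps by (simp add: abs_mult mult_left_mono)
      then have "0 < cos (d * t)" using d(3) by (intro cos_gt_zero_pi) auto
      then show "0 < 1 * Re (v ^ d * cnj (y ^ d))"
        unfolding t(1) power_mult_cis_cnj[OF y] by simp
    qed
    then show ?thesis by (simp add: u_def)
  qed
  have "continuous_on circle (\<lambda>y. h y - Ln (u y))"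
  proof (intro continuous_on_diff continuous_on_Ln')
    show "continuous_on circle h" by (rule continuous_on_subset[OF h(1)]) auto
    show "continuous_on circle u"
      unfolding u_def
      by (intro continuous_intros continuous_on_compose2[OF continuous_on_power_sum continuous_on_loop]) auto
    show "u y \<notin> \<real>\<^sub>\<le>\<^sub>0" if "y \<in> circle" for y
      using u_pos[OF that] by (auto simp: complex_nonpos_Reals_iff)
  qed
  moreover have "y ^ d = exp (h y - Ln (u y))" if y: "y \<in> circle" for y
  proof -
    have "y ^ d * cnj (y ^ d) = 1" using power_mult_cis_cnj[OF y, of 0 d] by simp
    then have "y ^ d * u y = ?F (loop y)" by (simp add: u_def mult.left_commute mult.commute)
    moreover have "?F (loop y) = exp (h y)" using h(2)[of y] g(3)[OF y] y by simp
    moreover have "u y \<noteq> 0" using u_pos[OF y] by auto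
    ultimately show ?thesis by (simp add: exp_diff field_simps)
  qed
  ultimately have "d = 0" by (rule no_continuous_logarithm_power)
  then show False using d(1) by simp
qed

lemma conn_neighborhood_complex:
  fixes d :: nat and m :: int
  assumes "0 < d" "\<bar>d * \<alpha> - m * pi\<bar> < pi / 3" "d * \<epsilon> < pi / 6"
  shows "conn (geometric_realization (neighborhood_complex G)) = 0"
  unfolding geometric_realization_eq
proof (intro conn_eq_0I k_connected_0_if_path_connected path_connected_realization not_1_connected[OF assms])
  show "realization (neighborhood_complex G) \<noteq> {}"
    using loop_in_realization[of 1] by auto
qed

end

text \<open>With 3 \<open>k\<close> arcs an edge spans about \<open>s * k\<close> arcs, where
  \<open>s\<close> = 3 \<alpha> / (2 pi). The least \<open>k\<close> with \<open>s * k > 1\<close>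
  works: for \<open>s < 1\<close> it gives at most 1 + \<open>s\<close>, and for
  \<open>s > 1\<close> it is 1. The excluded angle is \<open>s = 1\<close>.\<close>

lemma three_coloring_arcs:
  fixes \<alpha> :: real
  assumes "0 < \<alpha>" "\<alpha> \<le> pi" "\<alpha> \<noteq> 2 * pi / 3"
  obtains k :: nat where "1 < \<alpha> * (3 * k) / (2 * pi)" "\<alpha> * (3 * k) / (2 * pi) < 2"
proof -
  define s where "s = 3 * \<alpha> / (2 * pi)"
  have s: "0 < s" "s \<le> 3 / 2" "s \<noteq> 1" using assms by (auto simp: s_def field_simps)
  define k where "k = nat (\<lfloor>1 / s\<rfloor> + 1)"
  have k: "real k = of_int \<lfloor>1 / s\<rfloor> + 1"
    using s by (simp add: k_def)
  have "1 / s < k" "k \<le> 1 / s + 1" unfolding k by linarith+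
  then have "1 < s * k" "s * k \<le> 1 + s" using s by (auto simp: field_simps)
  moreover have "s * k < 2"
  proof (cases "s < 1")
    case False
    then have "\<lfloor>1 / s\<rfloor> = 0" using s by (intro floor_unique) (auto simp: field_simps)
    then show ?thesis using k s by simp
  qed (use calculation in linarith)
  moreover have "s * k = \<alpha> * (3 * k) / (2 * pi)" by (simp add: s_def)
  ultimately show ?thesis using that by metis
qed

section \<open>Invariance under isomorphism\<close>

text \<open>The inverse is carried along explicitly, and all conditions are restricted to vertices
  because \<open>adj\<close> may take arbitrary values elsewhere.\<close>

definition graph_iso :: "('a \<Rightarrow> 'b) \<Rightarrow> ('b \<Rightarrow> 'a) \<Rightarrow> 'a sgraph \<Rightarrow> 'b sgraph \<Rightarrow> bool" where
  "graph_iso \<phi> \<psi> G H \<longleftrightarrow>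
     (\<forall>v\<in>verts G. \<phi> v \<in> verts H \<and> \<psi> (\<phi> v) = v) \<and>
     (\<forall>w\<in>verts H. \<psi> w \<in> verts G \<and> \<phi> (\<psi> w) = w) \<and>
     (\<forall>v\<in>verts G. \<forall>w\<in>verts G. adj H (\<phi> v) (\<phi> w) \<longleftrightarrow> adj G v w)"

lemma graph_iso_sym:
  assumes "graph_iso \<phi> \<psi> G H"
  shows "graph_iso \<psi> \<phi> H G"
proof -
  have "adj G (\<psi> v) (\<psi> w) \<longleftrightarrow> adj H v w" if "v \<in> verts H" "w \<in> verts H" for v w
    using assms that unfolding graph_iso_def by metis
  then show ?thesis using assms unfolding graph_iso_def by blast
qed

lemma colorable_iso:
  assumes "graph_iso \<phi> \<psi> G H" "colorable G k"
  shows "colorable H k"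
proof -
  obtain c where "c ` verts G \<subseteq> {..<k}" "\<forall>v\<in>verts G. \<forall>w\<in>verts G. adj G v w \<longrightarrow> c v \<noteq> c w"
    using assms(2) unfolding colorable_def by blast
  then show ?thesis
    using graph_iso_sym[OF assms(1)] unfolding colorable_def graph_iso_def
    by (intro exI[of _ "c \<circ> \<psi>"]) (auto simp: image_subset_iff)
qed

lemma chromatic_number_iso:
  assumes "graph_iso \<phi> \<psi> G H"
  shows "chromatic_number G = chromatic_number H"
  using colorable_iso[OF assms] colorable_iso[OF graph_iso_sym[OF assms]]
  unfolding chromatic_number_def by metis

lemma neighborhood_complex_iso:
  assumes iso: "graph_iso \<phi> \<psi> G H" and A: "A \<in> neighborhood_complex G"
  shows "\<phi> ` A \<in> neighborhood_complex H"
proof -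
  have fin: "finite A" and sub: "A \<subseteq> verts G"
    using A by (auto simp: neighborhood_complex_def)
  have "(\<Inter>v\<in>\<phi> ` A. neighbors H v) \<noteq> {}"
  \<comment> \<open>For the empty simplex the intersection is the whole type; otherwise
    \<open>z\<close> is a vertex and its image is a common neighbour.\<close>
  proof (cases "A = {}")
    case False
    obtain z where z: "z \<in> (\<Inter>v\<in>A. neighbors G v)" using A by (auto simp: neighborhood_complex_def)
    then have "\<phi> z \<in> (\<Inter>v\<in>\<phi> ` A. neighbors H v)"
      using False sub iso unfolding neighbors_def graph_iso_def by auto
    then show ?thesis by blast
  qed simp
  moreover have "\<phi> ` A \<subseteq> verts H" using sub iso unfolding graph_iso_def by blast
  ultimately show ?thesis using fin by (simp add: neighborhood_complex_def)
qed

text \<open>The pushforward of barycentric coordinates along an isomorphism, expressed through its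
  inverse \<open>\<psi>\<close> and padded by zero off the vertex set.\<close>

definition transport :: "('b \<Rightarrow> 'a) \<Rightarrow> 'b set \<Rightarrow> ('a \<Rightarrow> real) \<Rightarrow> 'b \<Rightarrow> real" where
  "transport \<psi> W f w = (if w \<in> W then f (\<psi> w) else 0)"

lemma continuous_map_transport:
  assumes iso: "graph_iso \<phi> \<psi> G H"
  shows "continuous_map (geometric_realization (neighborhood_complex G))
    (geometric_realization (neighborhood_complex H)) (transport \<psi> (verts H))"
proof -
  have "continuous_on (realization (neighborhood_complex G)) (transport \<psi> (verts H))"
  proof (rule continuous_on_coordinatewise_then_product)
    show "continuous_on (realization (neighborhood_complex G)) (\<lambda>f. transport \<psi> (verts H) f w)" for w
      unfolding transport_def by (cases "w \<in> verts H") (auto intro: continuous_on_coordinate)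
  qed
  moreover have "transport \<psi> (verts H) f \<in> realization (neighborhood_complex H)"
    if f: "f \<in> realization (neighborhood_complex G)" for f
  proof (rule realizationI[of _ _ "\<phi> ` {v. f v \<noteq> 0}"])
    have A: "{v. f v \<noteq> 0} \<in> neighborhood_complex G" using realizationD(2)[OF f] .
    then have fin: "finite {v. f v \<noteq> 0}" and sub: "{v. f v \<noteq> 0} \<subseteq> verts G"
      by (auto simp: neighborhood_complex_def)
    have supp: "{w. transport \<psi> (verts H) f w \<noteq> 0} = \<phi> ` {v. f v \<noteq> 0}" (is "?L = ?R")
    proof (intro set_eqI iffI)
      fix w assume "w \<in> ?L"
      then have "w \<in> verts H" "f (\<psi> w) \<noteq> 0" by (auto simp: transport_def split: if_splits)
      moreover have "w = \<phi> (\<psi> w)" using iso calculation(1) unfolding graph_iso_def by metis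
      ultimately show "w \<in> ?R" by blast
    next
      fix w assume "w \<in> ?R"
      then obtain v where v: "w = \<phi> v" "f v \<noteq> 0" by blast
      then have "v \<in> verts G" using sub by blast
      then show "w \<in> ?L" using v iso unfolding graph_iso_def transport_def by simp
    qed
    show "0 \<le> transport \<psi> (verts H) f w" for w
      using realizationD(1)[OF f] by (simp add: transport_def)
    show "{w. transport \<psi> (verts H) f w \<noteq> 0} \<in> neighborhood_complex H"
      unfolding supp using iso A by (rule neighborhood_complex_iso)
    show "?L \<subseteq> ?R" using supp by simp
    show "finite ?R" using fin by simp
    have inv: "\<phi> v \<in> verts H" "\<psi> (\<phi> v) = v" if "v \<in> {v. f v \<noteq> 0}" for v
      using that sub iso unfolding graph_iso_def by blast+
    have "sum (transport \<psi> (verts H) f) ?R = sum f {v. f v \<noteq> 0}"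
      using inv by (intro sum.reindex_cong[of \<phi>]) (auto simp: transport_def intro: inj_on_inverseI)
    then show "sum (transport \<psi> (verts H) f) ?R = 1"
      using realizationD(3)[OF f fin] by simp
  qed
  ultimately show ?thesis
    unfolding geometric_realization_eq by auto
qed

lemma k_connected_neighborhood_complex_iso:
  assumes iso: "graph_iso \<phi> \<psi> G H"
    and "k_connected k (geometric_realization (neighborhood_complex G))"
  shows "k_connected k (geometric_realization (neighborhood_complex H))"
proof (rule k_connected_retract[OF assms(2) continuous_map_transport[OF iso]
      continuous_map_transport[OF graph_iso_sym[OF iso]]])
  fix f assume "f \<in> topspace (geometric_realization (neighborhood_complex H))"
  then have "{w. f w \<noteq> 0} \<subseteq> verts H"
    using realizationD(2) by (fastforce simp: geometric_realization_eq neighborhood_complex_def)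
  then show "transport \<psi> (verts H) (transport \<phi> (verts G) f) = f"
    using iso by (fastforce simp: fun_eq_iff transport_def graph_iso_def)
qed

lemma conn_neighborhood_complex_iso:
  assumes "graph_iso \<phi> \<psi> G H"
  shows "conn (geometric_realization (neighborhood_complex G)) =
    conn (geometric_realization (neighborhood_complex H))"
  using k_connected_neighborhood_complex_iso[OF assms]
    k_connected_neighborhood_complex_iso[OF graph_iso_sym[OF assms]]
  unfolding conn_def by metis

text \<open>Sample points may coincide. As the coincidences agree in \<open>x\<close> and
  \<open>y\<close>, sending \<open>x i\<close> to \<open>y i\<close> does not depend on the index
  that \<open>inv_into\<close> selects.\<close>

lemma graph_iso_of_same_pattern:
  fixes x y :: "'i \<Rightarrow> 'a"
  assumes "verts G = x ` I" "verts H = y ` I"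
    and eq: "\<And>i j. i \<in> I \<Longrightarrow> j \<in> I \<Longrightarrow> x i = x j \<longleftrightarrow> y i = y j"
    and adj: "\<And>i j. i \<in> I \<Longrightarrow> j \<in> I \<Longrightarrow> adj G (x i) (x j) \<longleftrightarrow> adj H (y i) (y j)"
  shows "\<exists>\<phi> \<psi>. graph_iso \<phi> \<psi> G H"
proof (intro exI)
  have x: "inv_into I x (x i) \<in> I" "x (inv_into I x (x i)) = x i" if "i \<in> I" for i
    using that by (auto intro: inv_into_into f_inv_into_f)
  have y: "inv_into I y (y i) \<in> I" "y (inv_into I y (y i)) = y i" if "i \<in> I" for i
    using that by (auto intro: inv_into_into f_inv_into_f)
  have xy: "(y \<circ> inv_into I x) (x i) = y i" and yx: "(x \<circ> inv_into I y) (y i) = x i" if "i \<in> I" for i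
    using x[OF that] y[OF that] eq that by (auto simp: o_def)
  show "graph_iso (y \<circ> inv_into I x) (x \<circ> inv_into I y) G H"
    unfolding graph_iso_def assms(1,2) using xy yx adj by (auto simp del: o_apply)
qed

section \<open>Measurability\<close>

text \<open>The event is a union of atoms \<open>B S\<close>, on which the truth values of all
  \<open>Q j\<close> are fixed; finitely many measurable \<open>Q j\<close> yield finitely many
  measurable atoms.\<close>

lemma sets_Collect_finite_pattern:
  assumes "finite J"
    and Q: "\<And>j. j \<in> J \<Longrightarrow> {x \<in> space M. Q j x} \<in> sets M"
    and inv: "\<And>x y. \<lbrakk>x \<in> space M; y \<in> space M; \<forall>j\<in>J. Q j x \<longleftrightarrow> Q j y; P x\<rbrakk> \<Longrightarrow> P y"
  shows "{x \<in> space M. P x} \<in> sets M"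
proof -
  define T where "T x = {j\<in>J. Q j x}" for x
  define B where "B S = {x \<in> space M. \<forall>j\<in>J. Q j x \<longleftrightarrow> j \<in> S}" for S
  have "B S \<in> sets M" for S
    unfolding B_def using Q assms(1)
    by (intro sets.sets_Collect_finite_All) (auto simp: sets.sets_Collect_neg)
  moreover have "T ` {x \<in> space M. P x} \<subseteq> Pow J" unfolding T_def by blast
  then have "finite (T ` {x \<in> space M. P x})" using assms(1) finite_subset by blast
  ultimately have "(\<Union>S\<in>T ` {x \<in> space M. P x}. B S) \<in> sets M" by blast
  moreover have "{x \<in> space M. P x} = (\<Union>S\<in>T ` {x \<in> space M. P x}. B S)"
  proof (intro set_eqI iffI)
    fix x assume "x \<in> {x \<in> space M. P x}"
    then show "x \<in> (\<Union>S\<in>T ` {x \<in> space M. P x}. B S)"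
      unfolding B_def T_def by auto
  next
    fix x assume "x \<in> (\<Union>S\<in>T ` {x \<in> space M. P x}. B S)"
    then obtain y where "y \<in> space M" "P y" "x \<in> space M" "\<forall>j\<in>J. Q j x \<longleftrightarrow> j \<in> T y"
      unfolding B_def by blast
    then show "x \<in> {x \<in> space M. P x}"
      using inv[of y x] unfolding T_def by blast
  qed
  ultimately show ?thesis by simp
qed

lemma sets_uniform_circle: "sets uniform_circle = sets (restrict_space borel circle)"
  and space_uniform_circle: "space uniform_circle = circle"
  by (simp_all add: uniform_circle_def space_restrict_space)

lemma prob_space_iid_circle: "prob_space (iid_circle n)"
proof -
  have "cis \<in> measurable (uniform_measure lborel {0..<2 * pi}) (restrict_space borel circle)"
    by (intro measurable_restrict_space2)
      (auto intro!: borel_measurable_continuous_onI continuous_intros simp: measurable_cong_sets[OF sets_uniform_measure refl])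
  moreover have "prob_space (uniform_measure lborel {0..<2 * pi})"
    by (intro prob_space_uniform_measure) auto
  ultimately have "prob_space uniform_circle"
    unfolding uniform_circle_def by (intro prob_space.prob_space_distr)
  then show ?thesis
    unfolding iid_circle_def by (intro prob_space_PiM)
qed

lemma space_iid_circle: "space (iid_circle n) = {1..n} \<rightarrow>\<^sub>E circle"
  by (simp add: iid_circle_def space_PiM space_uniform_circle)

lemma measurable_iid_circle_component [measurable]:
  assumes "i \<in> {1..n}"
  shows "(\<lambda>x. x i) \<in> borel_measurable (iid_circle n)"
proof -
  have "(\<lambda>x. x i) \<in> measurable (iid_circle n) uniform_circle"
    unfolding iid_circle_def using assms by (rule measurable_component_singleton)
  moreover have "(\<lambda>x. x) \<in> measurable uniform_circle borel"
    unfolding measurable_cong_sets[OF sets_uniform_circle refl]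
    by (intro measurable_restrict_space1) simp
  ultimately show ?thesis using measurable_compose by blast
qed

text \<open>The continuity of \<open>arccos\<close> is used on [-1, 1], so the inner product is
  first shown to be measurable into that restricted space.\<close>

lemma measurable_geodesic_dist:
  assumes "i \<in> {1..n}" "j \<in> {1..n}"
  shows "(\<lambda>x. geodesic_dist (x i) (x j)) \<in> borel_measurable (iid_circle n)"
proof -
  have "(\<lambda>x. x i \<bullet> x j) \<in> measurable (iid_circle n) (restrict_space borel {-1..1})"
  proof (rule measurable_restrict_space2)
    show "(\<lambda>x. x i \<bullet> x j) \<in> borel_measurable (iid_circle n)"
      using assms by measurable
    show "(\<lambda>x. x i \<bullet> x j) \<in> space (iid_circle n) \<rightarrow> {-1..1}"
    proof
      fix x assume "x \<in> space (iid_circle n)"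
      then have "norm (x i) = 1" "norm (x j) = 1"
        using assms by (auto simp: space_iid_circle PiE_iff)
      then have "\<bar>x i \<bullet> x j\<bar> \<le> 1" using Cauchy_Schwarz_ineq2[of "x i" "x j"] by simp
      then show "x i \<bullet> x j \<in> {-1..1}" by auto
    qed
  qed
  moreover have "arccos \<in> measurable (restrict_space borel {-1..1}) borel"
    by (intro borel_measurable_continuous_on_restrict continuous_on_arccos')
  ultimately show ?thesis
    unfolding geodesic_dist_def by (rule measurable_compose)
qed

text \<open>
  \<open>measure\<close> is \<open>0\<close> on non-measurable sets, so measurability of the final event has to be
  established. It depends only on the isomorphism type of the graph, hence on
  finitely many measurable relations between the sample points.
\<close>

lemma sets_distance_graph_invariant:
  assumes inv: "\<And>\<phi> \<psi> G H :: complex sgraph. graph_iso \<phi> \<psi> G H \<Longrightarrow> P G \<Longrightarrow> P H"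
  shows "{x \<in> space (iid_circle n). P (distance_graph \<alpha> (x ` {1..n}) \<epsilon>)} \<in> sets (iid_circle n)"
proof -
  let ?M = "iid_circle n" and ?I = "{1..n}"
  let ?G = "\<lambda>x. distance_graph \<alpha> (x ` {1..n}) \<epsilon>"
  \<comment> \<open>The flag \<open>b\<close> distinguishes two kinds of relation: coincidence of
    sample points, and their distance lying in the edge window.\<close>
  define Q where "Q = (\<lambda>(b, i :: nat, j :: nat) x. if b then x i = x j
    else \<alpha> - \<epsilon> \<le> geodesic_dist (x i) (x j) \<and> geodesic_dist (x i) (x j) \<le> \<alpha> + (\<epsilon>::real))"
  show ?thesis
  proof (rule sets_Collect_finite_pattern[of "UNIV \<times> ?I \<times> ?I" _ Q])
    show "finite ((UNIV :: bool set) \<times> ?I \<times> ?I)" by simp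
    fix p assume "p \<in> (UNIV :: bool set) \<times> ?I \<times> ?I"
    then obtain b i j where p: "p = (b, i, j)" and ij: "i \<in> ?I" "j \<in> ?I" by blast
    note [measurable] = measurable_geodesic_dist[OF ij]
      measurable_iid_circle_component[OF ij(1)] measurable_iid_circle_component[OF ij(2)]
    show "{x \<in> space ?M. Q p x} \<in> sets ?M"
      unfolding p Q_def by (cases b) simp_all
  next
    fix x y
    assume same: "\<forall>p\<in>UNIV \<times> ?I \<times> ?I. Q p x \<longleftrightarrow> Q p y" and P: "P (?G x)"
    have "x i = x j \<longleftrightarrow> y i = y j" if "i \<in> ?I" "j \<in> ?I" for i j
      using same[rule_format, of "(True, i, j)"] that by (simp add: Q_def)
    moreover have "\<alpha> - \<epsilon> \<le> geodesic_dist (x i) (x j) \<and> geodesic_dist (x i) (x j) \<le> \<alpha> + \<epsilon> \<longleftrightarrow>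
        \<alpha> - \<epsilon> \<le> geodesic_dist (y i) (y j) \<and> geodesic_dist (y i) (y j) \<le> \<alpha> + \<epsilon>"
      if "i \<in> ?I" "j \<in> ?I" for i j
      using same[rule_format, of "(False, i, j)"] that by (simp add: Q_def)
    ultimately obtain \<phi> \<psi> where "graph_iso \<phi> \<psi> (?G x) (?G y)"
      using graph_iso_of_same_pattern[of "?G x" x ?I "?G y" y] by (auto simp: distance_graph_def)
    then show "P (?G y)" using inv P by blast
  qed
qed

text \<open>The probability of \<open>Q\<close> is squeezed between that of \<open>P\<close> and 1;
  measurability of \<open>Q\<close> gives the monotonicity of \<open>measure\<close>.\<close>

lemma aas_eventually_mono:
  assumes "aas P"
    and "\<And>n. {x \<in> space (iid_circle n). Q n x} \<in> sets (iid_circle n)"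
    and "\<forall>\<^sub>F n in sequentially. \<forall>x \<in> space (iid_circle n). P n x \<longrightarrow> Q n x"
  shows "aas Q"
  unfolding aas_def
proof (rule tendsto_sandwich)
  show "(\<lambda>n. measure (iid_circle n) {x \<in> space (iid_circle n). P n x}) \<longlonglongrightarrow> 1"
    using assms(1) unfolding aas_def .
  show "\<forall>\<^sub>F n in sequentially. measure (iid_circle n) {x \<in> space (iid_circle n). P n x}
      \<le> measure (iid_circle n) {x \<in> space (iid_circle n). Q n x}"
    using assms(3)
  proof eventually_elim
    case (elim n)
    interpret prob_space "iid_circle n" by (rule prob_space_iid_circle)
    show ?case using elim assms(2)[of n] by (intro finite_measure_mono) auto
  qed
  show "\<forall>\<^sub>F n in sequentially. measure (iid_circle n) {x \<in> space (iid_circle n). Q n x} \<le> 1"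
    using prob_space.prob_le_1[OF prob_space_iid_circle] by (intro always_eventually) blast
qed simp

section \<open>Small distances\<close>

text \<open>With \<delta> \<le> 0 the net would be the whole circle, which is infinite. This
  supplies the positivity of \<epsilon> from the net property.\<close>

lemma circle_net_finite_pos:
  assumes "finite X" "circle_net \<delta> X"
  shows "0 < \<delta>"
proof (rule ccontr)
  assume "\<not> 0 < \<delta>"
  have "y \<in> X" if y: "y \<in> circle" for y
  proof -
    obtain x where x: "x \<in> X" "geodesic_dist y x \<le> \<delta>"
      using assms(2) y unfolding circle_net_def by blast
    then have "x \<in> circle" using assms(2) unfolding circle_net_def by blast
    then obtain t where t: "x = y * cis t" "\<bar>t\<bar> = geodesic_dist y x"
      using circle_eq_mult_cis[OF y] by metis
    have "t = 0" using t(2) x(2) \<open>\<not> 0 < \<delta>\<close> by simp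
    then show ?thesis using x(1) t(1) by simp
  qed
  then have "finite circle" by (intro finite_subset[OF _ assms(1)] subsetI)
  moreover have "connected circle" by (intro connected_sphere) simp
  ultimately obtain a where "circle \<subseteq> {a}"
    by (metis connected_finite_iff_sing empty_subsetI order_refl)
  moreover have "1 \<in> circle" "-1 \<in> circle" by simp_all
  ultimately have "(1 :: complex) = -1" by blast
  then show False by simp
qed

text \<open>The conclusion as a property of a single graph, which makes its invariance under
  isomorphism expressible.\<close>

definition typical :: "real \<Rightarrow> complex sgraph \<Rightarrow> bool" where
  "typical \<alpha> G \<longleftrightarrow>
     (0 < \<alpha> \<and> \<alpha> \<le> pi \<longrightarrow> conn (geometric_realization (neighborhood_complex G)) = 0) \<and>
     (0 < \<alpha> \<and> \<alpha> \<le> pi \<and> \<alpha> \<noteq> 2 * pi / 3 \<longrightarrow> chromatic_number G = 3) \<and>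
     (\<alpha> = 2 * pi / 3 \<longrightarrow> chromatic_number G = 4)"

lemma typical_iso:
  assumes "graph_iso \<phi> \<psi> G H" "typical \<alpha> G"
  shows "typical \<alpha> H"
  using assms(2) chromatic_number_iso[OF assms(1)] conn_neighborhood_complex_iso[OF assms(1)]
  unfolding typical_def by simp

text \<open>The threshold depends on \<alpha> and the sequence \<epsilon> alone; uniformity in
  \<open>X\<close> allows the result to be applied to every sample.\<close>

lemma eventually_typical:
  assumes \<epsilon>: "\<epsilon> \<longlonglongrightarrow> 0"
  shows "\<forall>\<^sub>F n in sequentially. \<forall>X. finite X \<longrightarrow> circle_net (\<epsilon> n / 4) X \<longrightarrow>
    typical \<alpha> (distance_graph \<alpha> X (\<epsilon> n))"
proof (cases "0 < \<alpha> \<and> \<alpha> \<le> pi")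
  case False
  have "0 < 2 * pi / 3" "2 * pi / 3 \<le> pi" by simp_all
  then have "\<alpha> \<noteq> 2 * pi / 3" using False by metis
  then have "typical \<alpha> G" for G using False by (auto simp: typical_def)
  then show ?thesis by simp
next
  case True
  then have \<alpha>: "0 < \<alpha>" "\<alpha> \<le> pi" by auto
  \<comment> \<open>The denominator 3 yields an error below pi / 3, which leaves pi / 6 for the
    contribution of \<epsilon>.\<close>
  obtain m k :: int where k: "0 < k" "\<bar>of_int k * (\<alpha> / pi) - of_int m\<bar> < 1 / 3"
    using Dirichlet_approx[of 3 "\<alpha> / pi"] by (metis of_nat_numeral zero_less_numeral)
  define d where "d = nat k"
  have "\<bar>real d * \<alpha> - m * pi\<bar> = pi * \<bar>of_int k * (\<alpha> / pi) - of_int m\<bar>"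
    using k(1) by (simp add: d_def abs_mult field_simps flip: abs_mult_pos)
  also have "\<dots> < pi * (1 / 3)" using k(2) by (intro mult_strict_left_mono) auto
  finally have dm: "\<bar>real d * \<alpha> - m * pi\<bar> < pi / 3" by simp
  have d: "0 < d" using k(1) by (simp add: d_def)
  define q :: nat where "q = (if \<alpha> = 2 * pi / 3 then 4 else 3)"
  \<comment> \<open>Both inequalities are strict, so they survive replacing \<alpha> by \<alpha> -
    \<epsilon> and \<alpha> + \<epsilon> for large \<open>n\<close>. For \<alpha> = 2 pi / 3, four
    arcs suffice, and an edge spans about 4 / 3 of them.\<close>
  obtain j :: nat where j: "1 < \<alpha> * (q * j) / (2 * pi)" "\<alpha> * (q * j) / (2 * pi) < real q - 1"
  proof (cases "\<alpha> = 2 * pi / 3")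
    case True
    then have "\<alpha> * (real q * real 1) / (2 * pi) = 4 / 3" "real q = 4"
      by (simp_all add: q_def field_simps)
    then show ?thesis by - (rule that[of 1], linarith+)
  next
    case False
    then show ?thesis using three_coloring_arcs[OF \<alpha> False] that by (auto simp: q_def)
  qed
  have lim: "(\<lambda>n. (\<alpha> - \<epsilon> n) * (q * j) / (2 * pi)) \<longlonglongrightarrow> (\<alpha> - 0) * (q * j) / (2 * pi)"
    "(\<lambda>n. (\<alpha> + \<epsilon> n) * (q * j) / (2 * pi)) \<longlonglongrightarrow> (\<alpha> + 0) * (q * j) / (2 * pi)"
    "(\<lambda>n. d * \<epsilon> n) \<longlonglongrightarrow> real d * 0"
    by (intro tendsto_intros \<epsilon>; simp)+
  have "\<forall>\<^sub>F n in sequentially. 1 < (\<alpha> - \<epsilon> n) * (q * j) / (2 * pi)"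
    "\<forall>\<^sub>F n in sequentially. (\<alpha> + \<epsilon> n) * (q * j) / (2 * pi) < real q - 1"
    "\<forall>\<^sub>F n in sequentially. d * \<epsilon> n < pi / 6"
    by (rule order_tendstoD(1)[OF lim(1)] order_tendstoD(2)[OF lim(2)] order_tendstoD(2)[OF lim(3)];
        use j in simp)+
  moreover have "\<forall>\<^sub>F n in sequentially. \<epsilon> n < \<alpha>" using \<epsilon> \<alpha> by (auto elim!: order_tendstoD)
  ultimately show ?thesis
  proof eventually_elim
    case (elim n)
    show ?case
    proof (intro allI impI)
      fix X assume X: "finite X" "circle_net (\<epsilon> n / 4) X"
      interpret dense_distance_graph \<alpha> "\<epsilon> n" X
        using X \<alpha> elim(4) circle_net_finite_pos[OF X] by unfold_locales auto
      have "colorable G q"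
        using X(2) elim(1,2) by (intro colorable_distance_graph[of _ _ _ _ j]) (auto simp: circle_net_def)
      moreover have "\<not> colorable G (q - 1)"
        using not_colorable_2 not_colorable_3 by (simp add: q_def)
      moreover have "Suc (q - 1) = q" by (simp add: q_def)
      ultimately have "chromatic_number G = enat q"
        using chromatic_number_eqI[of G "q - 1"] by simp
      then show "typical \<alpha> G"
        using conn_neighborhood_complex[OF d dm elim(3)] unfolding typical_def
        by (simp add: q_def numeral_eq_enat)
    qed
  qed
qed

theorem theorem4p6:
  fixes C\<^sub>1 \<alpha> :: real and \<epsilon> :: "nat \<Rightarrow> real"
  assumes "net_constant C\<^sub>1"
    and "\<forall>n\<ge>1. \<epsilon> n \<ge> C\<^sub>1 * ln (real n) / real n"
    and "\<epsilon> \<longlonglongrightarrow> 0"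
  shows "aas (\<lambda>n x.
    let G = distance_graph \<alpha> (x ` {1..n}) (\<epsilon> n) in
      (0 < \<alpha> \<and> \<alpha> \<le> pi \<longrightarrow>
         conn (geometric_realization (neighborhood_complex G)) = 0) \<and>
      (0 < \<alpha> \<and> \<alpha> \<le> pi \<and> \<alpha> \<noteq> 2 * pi / 3 \<longrightarrow> chromatic_number G = 3) \<and>
      (\<alpha> = 2 * pi / 3 \<longrightarrow> chromatic_number G = 4))"
  unfolding Let_def typical_def[symmetric]
proof (rule aas_eventually_mono)
  \<comment> \<open>Here the lower bound on \<epsilon> enters, through the defining property of
    \<open>C\<^sub>1\<close>.\<close>
  show "aas (\<lambda>n x. circle_net (\<epsilon> n / 4) (x ` {1..n}))"
    using assms unfolding net_constant_def by blast
  show "{x \<in> space (iid_circle n). typical \<alpha> (distance_graph \<alpha> (x ` {1..n}) (\<epsilon> n))}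
      \<in> sets (iid_circle n)" for n
    using typical_iso by (rule sets_distance_graph_invariant)
  show "\<forall>\<^sub>F n in sequentially. \<forall>x\<in>space (iid_circle n). circle_net (\<epsilon> n / 4) (x ` {1..n}) \<longrightarrow>
      typical \<alpha> (distance_graph \<alpha> (x ` {1..n}) (\<epsilon> n))"
    using eventually_typical[OF assms(3), of \<alpha>] by eventually_elim auto
qed

end
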